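(* For a separable state $A\in\mathbb V_1$, the following are equivalent: (i) $\mathbb V_1[A]=\mathbb V_1\cap\mathbb T[A]$. (ii) $A$ is an interior point of $\mathbb V_1\cap\mathbb T[A]$. (iii) $P[A]=Q[A]$. (iv) For every $z\in Q[A]$ there exist product vectors $z_\iota\in Q[A]$ such that $A=zz^*+\sum_\iota z_\iota z_\iota^*$.
   Context: $M_n$ is the algebra of complex $n\times n$ matrices; $\{e_{ij}\}$ are the matrix units of $M_m$. $\mathbb V_1$ is the convex cone in $M_m\otimes M_n$ generated by all separable states, i.e. all finite sums of matrices $zz^*$ with $z=x\otimes y$ a product vector in $\mathbb C^m\otimes\mathbb C^n$ (elements of $\mathbb V_1$ are called separable states without requiring normalization). For $A=\sum e_{ij}\otimes x_{ij}$ the partial transpose is $A^\Gamma=\sum e_{ij}\otimes x_{ji}$. $\mathbb T$ is the convex cone of all positive semi-definite $A\in M_m\otimes M_n$ with $A^\Gamma$ positive semi-definite; $\mathbb V_1\subset\mathbb T$. A convex subset $F$ of a convex set $C$ is a face of $C$ if $x,y\in C$ and $(1-t)x+ty\in F$ for some $t\in(0,1)$ imply $x,y\in F$. A point $x$ of a convex set $C$ is an interior point of $C$ if the line segment from any point of $C$ to $x$ can be extended (beyond $x$) within $C$; equivalently, $x$ lies in the relative interior of $C$ with respect to the affine manifold generated by $C$. For $A\in\mathbb V_1$: $\mathbb V_1[A]$ is the smallest face of $\mathbb V_1$ containing $A$; with $\mathcal R$ denoting range space, $\mathbb T[A]=\{B\in\mathbb T:\mathcal RB\subset\mathcal RA,\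 \mathcal RB^\Gamma\subset\mathcal RA^\Gamma\}$, which is the smallest face of $\mathbb T$ containing $A$; and $$P[A]=\{z=x\otimes y: zz^*\in\mathbb V_1[A]\},\qquad Q[A]=\{z=x\otimes y: x\otimes y\in\mathcal RA,\ \bar x\otimes y\in\mathcal RA^\Gamma\},$$ where $\bar x$ is the entrywise complex conjugate of $x$.
   Formalization: In (iv), z is taken up to a nonzero scalar: for every z in Q[A] there are c≠0 and finitely many z_ι in Q[A] with A=(cz)(cz)*+Σ z_ι z_ι*. Read literally, (iv) fails for every A≠0, because Q[A] is closed under scaling. *)

theory Defs
  imports "HOL-Analysis.Analysis"
begin

text \<open>
  \<open>M\<^sub>m \<otimes> M\<^sub>n\<close> is the space of complex matrices with rows and columns indexed by
  pairs: the entry of \<open>\<Sum> e\<^sub>i\<^sub>j \<otimes> x\<^sub>i\<^sub>j\<close> at row \<open>(i, k)\<close> and column \<open>(j, l)\<close> is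
  the \<open>(k, l)\<close> entry of \<open>x\<^sub>i\<^sub>j\<close>.
\<close>

type_synonym ('m, 'n) bivec = "complex ^ ('m \<times> 'n)"
type_synonym ('m, 'n) bimat = "complex ^ ('m \<times> 'n) ^ ('m \<times> 'n)"

definition prod_vec :: "complex ^ 'm \<Rightarrow> complex ^ 'n \<Rightarrow> ('m::finite, 'n::finite) bivec"
    (infixl \<open>\<otimes>\<^sub>v\<close> 70) where
  "x \<otimes>\<^sub>v y = (\<chi> p. x $ fst p * y $ snd p)"

definition cnj_vec :: "complex ^ 'i \<Rightarrow> complex ^ 'i::finite" where
  "cnj_vec x = (\<chi> i. cnj (x $ i))"

text \<open>The matrix \<open>z z\<^sup>*\<close>.\<close>

definition outer :: "complex ^ 'i \<Rightarrow> complex ^ 'i ^ 'i::finite" where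
  "outer z = (\<chi> p q. z $ p * cnj (z $ q))"

definition hermitian :: "complex ^ 'i ^ 'i::finite \<Rightarrow> bool" where
  "hermitian A \<longleftrightarrow> (\<forall>p q. A $ p $ q = cnj (A $ q $ p))"

definition psd :: "complex ^ 'i ^ 'i::finite \<Rightarrow> bool" where
  "psd A \<longleftrightarrow> hermitian A \<and> (\<forall>v. 0 \<le> Re (\<Sum>p\<in>UNIV. cnj (v $ p) * (A *v v) $ p))"

definition range_space :: "complex ^ 'i ^ 'i::finite \<Rightarrow> (complex ^ 'i) set" where
  "range_space A = range (\<lambda>v. A *v v)"

definition partial_transpose :: "('m::finite, 'n::finite) bimat \<Rightarrow> ('m, 'n) bimat" where
  "partial_transpose A = (\<chi> p q. A $ (fst q, snd p) $ (fst p, snd q))"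

text \<open>Separable states, not normalized.\<close>

definition VV1 :: "('m::finite, 'n::finite) bimat set" where
  "VV1 = {A. \<exists>zs. (\<forall>z\<in>set zs. \<exists>x y. z = x \<otimes>\<^sub>v y) \<and> A = (\<Sum>z\<leftarrow>zs. outer z)}"

definition TT :: "('m::finite, 'n::finite) bimat set" where
  "TT = {A. psd A \<and> psd (partial_transpose A)}"

definition smallest_face :: "'a::real_vector set \<Rightarrow> 'a \<Rightarrow> 'a set" where
  "smallest_face C x = \<Inter>{F. F face_of C \<and> x \<in> F}"

definition VV1_face :: "('m::finite, 'n::finite) bimat \<Rightarrow> ('m, 'n) bimat set" where
  "VV1_face A = smallest_face VV1 A"

definition TT_face :: "('m::finite, 'n::finite) bimat \<Rightarrow> ('m, 'n) bimat set" where
  "TT_face A = {B \<in> TT. range_space B \<subseteq> range_space A \<and>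
     range_space (partial_transpose B) \<subseteq> range_space (partial_transpose A)}"

definition interior_point :: "'a::real_vector \<Rightarrow> 'a set \<Rightarrow> bool" where
  "interior_point x C \<longleftrightarrow> x \<in> C \<and> (\<forall>y\<in>C. \<exists>t>1. (1 - t) *\<^sub>R y + t *\<^sub>R x \<in> C)"

lemma interior_point_iff_rel_interior:
  fixes C :: "'a::euclidean_space set"
  assumes "convex C"
  shows "interior_point x C \<longleftrightarrow> x \<in> rel_interior C"
proof (cases "C = {}")
  case True
  then show ?thesis by (simp add: interior_point_def)
next
  case False
  then show ?thesis
    using convex_rel_interior_iff[OF assms False, of x] rel_interior_subset[of C]
    by (auto simp: interior_point_def)
qed

definition PP :: "('m::finite, 'n::finite) bimat \<Rightarrow> ('m, 'n) bivec set" where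
  "PP A = {z. \<exists>x y. z = x \<otimes>\<^sub>v y \<and> outer z \<in> VV1_face A}"

text \<open>
  \<open>QQ A\<close> is closed under scalar multiplication, whereas an equation
  \<open>A = z z\<^sup>* + \<Sum> z\<^sub>i z\<^sub>i\<^sup>*\<close> bounds the norm of \<open>z\<close> by the trace of \<open>A\<close>. A condition
  that such a decomposition exists for every \<open>z\<close> in \<open>QQ A\<close> therefore only makes sense
  for \<open>z\<close> up to a nonzero scalar factor.
\<close>

definition QQ :: "('m::finite, 'n::finite) bimat \<Rightarrow> ('m, 'n) bivec set" where
  "QQ A = {z. \<exists>x y. z = x \<otimes>\<^sub>v y \<and> x \<otimes>\<^sub>v y \<in> range_space A \<and>
     cnj_vec x \<otimes>\<^sub>v y \<in> range_space (partial_transpose A)}"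

end

theory Submission
  imports Defs
begin

text \<open>
  In a convex cone \<open>C\<close> the smallest face containing \<open>A\<close> is \<open>{B \<in> C. \<exists>s>0. A - s B \<in> C}\<close>.
  All four conditions therefore say, in different words, that a positive multiple of every element
  of \<open>VV1 \<inter> TT_face A\<close> can be subtracted from \<open>A\<close> within \<open>VV1\<close>; since the range of a
  positive semidefinite summand lies in the range of the sum, it suffices to test this on the
  rank one elements \<open>outer z\<close>, which are those with \<open>z \<in> QQ A\<close>.
\<close>

subsection \<open>Faces of convex cones\<close>

text \<open>The element is a convex combination of \<open>A\<close> and
  \<open>A - s *\<^sub>R B\<close>, with weights \<open>1 - r / s\<close> and \<open>r / s\<close>.
  This allows the subtracted multiple to be shrunk at will.\<close>

lemma convex_cone_diff_scaleR_mono: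
  assumes "convex_cone C" "A \<in> C" "A - s *\<^sub>R B \<in> C" "0 \<le> r" "r \<le> s" "0 < s"
  shows "A - r *\<^sub>R B \<in> C"
proof -
  have "A - r *\<^sub>R B = (1 - r / s) *\<^sub>R A + (r / s) *\<^sub>R (A - s *\<^sub>R B)"
    using assms(6) by (simp add: algebra_simps)
  moreover have "0 \<le> 1 - r / s" "0 \<le> r / s" using assms by simp_all
  ultimately show ?thesis
    using assms by (metis convex_cone_add convex_cone_scaleR)
qed

lemma convex_cone_scaled_below:
  assumes C: "convex_cone C" and A: "A \<in> C"
  shows "convex_cone {B \<in> C. \<exists>s>0. A - s *\<^sub>R B \<in> C}" (is "convex_cone ?F")
  unfolding convex_cone_iff
proof (intro conjI ballI allI impI)
  show "0 \<in> ?F" using A C by (auto intro!: exI[of _ 1] simp: convex_cone_contains_0)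
next
  fix B D assume BF: "B \<in> ?F" and DF: "D \<in> ?F"
  from BF obtain s where s: "B \<in> C" "s > 0" "A - s *\<^sub>R B \<in> C" by blast
  from DF obtain t where t: "D \<in> C" "t > 0" "A - t *\<^sub>R D \<in> C" by blast
  \<comment> \<open>The half compensates for averaging: the mean of
    \<open>A - (2 * r) *\<^sub>R B\<close> and \<open>A - (2 * r) *\<^sub>R D\<close> subtracts
    exactly \<open>r\<close> times \<open>B + D\<close>.\<close>
  define r where "r = min s t / 2"
  have r: "r > 0" using s t by (simp add: r_def)
  have "A - (2 * r) *\<^sub>R B \<in> C" "A - (2 * r) *\<^sub>R D \<in> C"
    using convex_cone_diff_scaleR_mono[OF C A s(3)] convex_cone_diff_scaleR_mono[OF C A t(3)] s t
    by (simp_all add: r_def)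
  then have "(1/2) *\<^sub>R (A - (2 * r) *\<^sub>R B) + (1/2) *\<^sub>R (A - (2 * r) *\<^sub>R D) \<in> C"
    using C by (intro convex_cone_add convex_cone_scaleR) simp_all
  also have "(1/2) *\<^sub>R (A - (2 * r) *\<^sub>R B) + (1/2) *\<^sub>R (A - (2 * r) *\<^sub>R D)
      = A - r *\<^sub>R (B + D)"
  proof -
    define H where "H = (1/2) *\<^sub>R A"
    have AH: "A = H + H" by (simp add: H_def flip: scaleR_add_left)
    show ?thesis
      unfolding scaleR_diff_right H_def[symmetric] by (simp add: AH algebra_simps)
  qed
  finally show "B + D \<in> ?F" using s t C r by (auto intro: convex_cone_add)
next
  fix B and u :: real assume BF: "B \<in> ?F" and u: "0 \<le> u"
  from BF obtain s where s: "B \<in> C" "s > 0" "A - s *\<^sub>R B \<in> C" by blast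
  have uB: "u *\<^sub>R B \<in> C" using s u C by (simp add: convex_cone_scaleR)
  show "u *\<^sub>R B \<in> ?F"
  proof (cases "u = 0")
    case True
    then show ?thesis using A uB by (auto intro!: exI[of _ 1])
  next
    case False
    then have "s / u > 0" "A - (s / u) *\<^sub>R (u *\<^sub>R B) \<in> C" using s u by simp_all
    then show ?thesis using uB by blast
  qed
qed

text \<open>The right-hand side is a face because \<open>A - s *\<^sub>R x\<close>, for
  \<open>x\<close> between \<open>a\<close> and \<open>b\<close>, absorbs the share of either
  endpoint and stays in the cone. It lies in every face containing \<open>A\<close> because
  \<open>A\<close> is between \<open>B\<close> and a rescaled remainder
  \<open>A - s *\<^sub>R B\<close>.\<close>

lemma smallest_face_convex_cone:
  assumes C: "convex_cone C" and A: "A \<in> C"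
  shows "smallest_face C A = {B \<in> C. \<exists>s>0. A - s *\<^sub>R B \<in> C}" (is "_ = ?F")
proof
  have "convex ?F"
    using convex_cone_scaled_below[OF assms] by (simp add: convex_cone_def)
  moreover have "a \<in> ?F \<and> b \<in> ?F"
    if ab: "a \<in> C" "b \<in> C" and x: "x \<in> ?F" "x \<in> open_segment a b" for a b x
  proof -
    from x(2) obtain u where u: "0 < u" "u < 1" "x = (1 - u) *\<^sub>R a + u *\<^sub>R b"
      by (auto simp: in_segment)
    from x(1) obtain s where s: "s > 0" "A - s *\<^sub>R x \<in> C" by blast
    have "A - (s * (1 - u)) *\<^sub>R a = (A - s *\<^sub>R x) + (s * u) *\<^sub>R b"
      "A - (s * u) *\<^sub>R b = (A - s *\<^sub>R x) + (s * (1 - u)) *\<^sub>R a"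
      by (simp_all add: u algebra_simps)
    moreover have "(A - s *\<^sub>R x) + (s * u) *\<^sub>R b \<in> C" "(A - s *\<^sub>R x) + (s * (1 - u)) *\<^sub>R a \<in> C"
      using C ab s u by (auto intro!: convex_cone_add convex_cone_scaleR)
    ultimately have "A - (s * (1 - u)) *\<^sub>R a \<in> C" "A - (s * u) *\<^sub>R b \<in> C" by (simp_all only:)
    moreover have "s * (1 - u) > 0" "s * u > 0" using s u by simp_all
    ultimately show ?thesis using ab by blast
  qed
  ultimately have "?F face_of C" unfolding face_of_def by blast
  moreover have "A \<in> ?F"
    using A C by (auto intro!: exI[of _ 1] simp: convex_cone_contains_0)
  ultimately show "smallest_face C A \<subseteq> ?F" unfolding smallest_face_def by blast
next
  show "?F \<subseteq> smallest_face C A"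
    unfolding smallest_face_def
  proof (intro subsetI InterI)
    fix B G assume "B \<in> ?F" and "G \<in> {F. F face_of C \<and> A \<in> F}"
    then obtain r where r: "B \<in> C" "r > 0" "A - r *\<^sub>R B \<in> C" and G: "G face_of C" "A \<in> G"
      by blast
    \<comment> \<open>Capping \<open>s\<close> below 1 lets the remainder be divided by
      \<open>1 - s\<close>, so that \<open>A\<close> becomes a convex combination of
      \<open>D\<close> and \<open>B\<close>.\<close>
    define s where "s = min r (1/2)"
    have s: "0 < s" "s < 1" and AsB: "A - s *\<^sub>R B \<in> C"
      using convex_cone_diff_scaleR_mono[OF C A r(3)] r by (auto simp: s_def)
    define D where "D = (1 / (1 - s)) *\<^sub>R (A - s *\<^sub>R B)"
    have "D \<in> C" using C AsB s by (simp add: D_def convex_cone_scaleR)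
    have AD: "A = (1 - s) *\<^sub>R D + s *\<^sub>R B" using s by (simp add: D_def)
    show "B \<in> G"
    \<comment> \<open>If the endpoints coincide, the open segment is empty and the face property
      says nothing; but then \<open>A\<close> is \<open>B\<close> itself.\<close>
    proof (cases "D = B")
      case True
      then have "A = B" using AD by (simp flip: scaleR_add_left)
      then show ?thesis using G by simp
    next
      case False
      then have "A \<in> open_segment D B" using s AD by (auto simp: in_segment)
      then show ?thesis using G r \<open>D \<in> C\<close> by (meson face_ofD)
    qed
  qed
qed

lemma convex_cone_smallest_face:
  assumes "convex_cone C" "A \<in> C"
  shows "convex_cone (smallest_face C A)"
  using convex_cone_scaled_below[OF assms] by (simp add: smallest_face_convex_cone[OF assms])

lemma convex_cone_sum_list:
  assumes "convex_cone C" "\<And>z. z \<in> set zs \<Longrightarrow> f z \<in> C"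
  shows "(\<Sum>z\<leftarrow>zs. f z) \<in> C"
  using assms(2) by (induction zs) (auto simp: convex_cone_contains_0 convex_cone_add assms(1))

subsection \<open>Ranges of positive semidefinite operators\<close>

text \<open>Perturb \<open>v\<close> in the direction of \<open>f v\<close>: the quadratic form at
  \<open>v - t *\<^sub>R f v\<close> is \<open>t * (t * b - 2 * a)\<close> with \<open>a\<close> the
  squared norm of \<open>f v\<close>, which is negative for small positive \<open>t\<close> unless
  \<open>f v\<close> vanishes.\<close>

lemma positive_self_adjoint_eq_0:
  fixes f :: "'a::euclidean_space \<Rightarrow> 'a"
  assumes f: "linear f" and adj: "\<And>x y. f x \<bullet> y = x \<bullet> f y" and pos: "\<And>x. 0 \<le> x \<bullet> f x"
    and v: "v \<bullet> f v = 0"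
  shows "f v = 0"
proof (rule ccontr)
  assume nz: "f v \<noteq> 0"
  define a where "a = f v \<bullet> f v"
  define b where "b = f v \<bullet> f (f v)"
  have a: "a > 0" using nz by (simp add: a_def)
  have b: "b \<ge> 0" using pos by (simp add: b_def)
  have expand: "(v - t *\<^sub>R f v) \<bullet> f (v - t *\<^sub>R f v) = t * (t * b - 2 * a)" for t
    using v adj[of v "f v"]
    by (simp add: linear_diff[OF f] linear_cmul[OF f] inner_diff a_def b_def algebra_simps)
  have "0 \<le> t * (t * b - 2 * a)" for t
    using pos[of "v - t *\<^sub>R f v"] unfolding expand .
  \<comment> \<open>The choice \<open>t = a / (b + 1)\<close> makes \<open>t * b\<close> at most
    \<open>a\<close>; the added 1 covers the case \<open>b = 0\<close>.\<close>
  then have "0 \<le> a / (b + 1) * (a / (b + 1) * b - 2 * a)" .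
  moreover have "0 < a / (b + 1)" using a b by simp
  ultimately have "0 \<le> a / (b + 1) * b - 2 * a" by (metis linorder_not_less mult_pos_neg)
  moreover have "a / (b + 1) * b \<le> a" using a b by (simp add: field_simps)
  ultimately show False using a by linarith
qed

text \<open>For a self-adjoint map the kernel is the orthogonal complement of the range. Two
  nonnegative quadratic forms with sum zero at \<open>v\<close> both vanish there, so the kernel of
  the sum lies in that of \<open>f\<close>; taking complements reverses the inclusion.\<close>

lemma range_subset_range_add_positive:
  fixes f g :: "'a::euclidean_space \<Rightarrow> 'a"
  assumes f: "linear f" "\<And>x y. f x \<bullet> y = x \<bullet> f y" "\<And>x. 0 \<le> x \<bullet> f x"
    and g: "linear g" "\<And>x y. g x \<bullet> y = x \<bullet> g y" "\<And>x. 0 \<le> x \<bullet> g x"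
  shows "range f \<subseteq> range (\<lambda>x. f x + g x)"
proof -
  let ?h = "\<lambda>x. f x + g x"
  have h: "linear ?h" using f(1) g(1) by (rule linear_compose_add)
  have "adjoint ?h = ?h"
    by (rule adjoint_unique) (simp add: inner_add f(2) g(2))
  then have "(range ?h)\<^sup>\<bottom> = ?h -` {0}"
    using ker_orthogonal_comp_adjoint[OF h] by simp
  have "adjoint f = f" by (rule adjoint_unique) (simp add: f(2))
  then have "(range f)\<^sup>\<bottom> = f -` {0}"
    using ker_orthogonal_comp_adjoint[OF f(1)] by simp
  have "v \<in> f -` {0}" if "v \<in> ?h -` {0}" for v
  proof -
    have "v \<bullet> f v + v \<bullet> g v = 0" using that by (simp flip: inner_add_right)
    then have "v \<bullet> f v = 0" using f(3)[of v] g(3)[of v] by linarith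
    then show ?thesis using positive_self_adjoint_eq_0[OF f] by simp
  qed
  then have "(range ?h)\<^sup>\<bottom> \<subseteq> (range f)\<^sup>\<bottom>"
    using \<open>(range ?h)\<^sup>\<bottom> = _\<close> \<open>(range f)\<^sup>\<bottom> = _\<close> by blast
  then have "(range f)\<^sup>\<bottom>\<^sup>\<bottom> \<subseteq> (range ?h)\<^sup>\<bottom>\<^sup>\<bottom>" by (rule orthogonal_comp_anti_mono)
  moreover have "subspace (range f)" "subspace (range ?h)"
    using f(1) h by (simp_all add: linear_subspace_image)
  ultimately show ?thesis by (simp add: orthogonal_comp_self)
qed

subsection \<open>Positive semidefinite matrices\<close>

lemma linear_matrix_vector_complex: "linear ((*v) (A :: complex ^ 'n ^ 'm))"
  by (rule linearI, rule matrix_vector_right_distrib)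
    (simp add: matrix_vector_mult_def vec_eq_iff scaleR_sum_right)

text \<open>Complex vectors are treated as a real Euclidean space, whose inner product is the real
  part of the Hermitian one. This makes the results on real operators applicable to
  \<open>psd\<close> matrices.\<close>

lemma inner_complex_vec: "x \<bullet> y = Re (\<Sum>p\<in>UNIV. cnj (x $ p) * y $ p)"
  for x y :: "complex ^ 'i"
  by (simp add: inner_vec_def inner_complex_def)

lemma psd_iff: "psd A \<longleftrightarrow> hermitian A \<and> (\<forall>v. 0 \<le> v \<bullet> (A *v v))"
  by (simp add: psd_def inner_complex_vec)

lemma hermitian_self_adjoint:
  assumes "hermitian A"
  shows "(A *v x) \<bullet> y = x \<bullet> (A *v y)"
proof -
  have "(\<Sum>p\<in>UNIV. cnj ((A *v x) $ p) * y $ p)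
      = (\<Sum>p\<in>UNIV. \<Sum>q\<in>UNIV. cnj (A $ p $ q) * cnj (x $ q) * y $ p)"
    by (simp add: matrix_vector_mult_def sum_distrib_right)
  also have "\<dots> = (\<Sum>q\<in>UNIV. \<Sum>p\<in>UNIV. cnj (A $ p $ q) * cnj (x $ q) * y $ p)"
    by (rule sum.swap)
  also have "\<dots> = (\<Sum>q\<in>UNIV. cnj (x $ q) * (A *v y) $ q)"
  proof -
    have "cnj (A $ p $ q) = A $ q $ p" for p q
      using assms by (metis hermitian_def)
    then show ?thesis by (simp add: matrix_vector_mult_def sum_distrib_left mult_ac)
  qed
  finally show ?thesis by (simp add: inner_complex_vec)
qed

lemma psd_0: "psd 0"
  by (simp add: psd_iff hermitian_def)

lemma hermitian_add: "hermitian A \<Longrightarrow> hermitian B \<Longrightarrow> hermitian (A + B)"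
  unfolding hermitian_def by (metis complex_cnj_add vector_add_component)

lemma psd_add: "psd A \<Longrightarrow> psd B \<Longrightarrow> psd (A + B)"
  by (simp add: psd_iff hermitian_add matrix_vector_mult_add_rdistrib inner_add_right)

lemma outer_mult_vec: "outer z *v v = (\<Sum>q\<in>UNIV. cnj (z $ q) * v $ q) *s z"
  by (simp add: outer_def matrix_vector_mult_def vec_eq_iff sum_distrib_left sum_distrib_right mult_ac)

text \<open>The quadratic form at \<open>v\<close> is the squared modulus of the Hermitian product
  of \<open>z\<close> and \<open>v\<close>.\<close>

lemma psd_outer: "psd (outer z)"
proof -
  have "0 \<le> v \<bullet> (outer z *v v)" for v
  proof -
    define c where "c = (\<Sum>q\<in>UNIV. cnj (z $ q) * v $ q)"
    have "(\<Sum>p\<in>UNIV. cnj (v $ p) * (outer z *v v) $ p) = c * cnj c"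
      unfolding outer_mult_vec c_def[symmetric]
      by (simp add: c_def sum_distrib_left mult_ac)
    then show ?thesis by (simp add: inner_complex_vec complex_mult_cnj del: complex_cnj_mult)
  qed
  then show ?thesis by (simp add: psd_iff hermitian_def outer_def)
qed

lemma range_space_subset_add:
  assumes "psd A" "psd B"
  shows "range_space A \<subseteq> range_space (A + B)"
  using range_subset_range_add_positive[of "(*v) A" "(*v) B"] assms
  by (simp add: range_space_def psd_iff linear_matrix_vector_complex hermitian_self_adjoint
      matrix_vector_mult_add_rdistrib)

lemma range_space_scaleR:
  assumes "s \<noteq> 0"
  shows "range_space (s *\<^sub>R A) = range_space A"
proof -
  have eq: "(s *\<^sub>R A) *v v = A *v (s *\<^sub>R v)" for v
    by (simp add: matrix_vector_mult_def vec_eq_iff)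
  have eq': "A *v v = (s *\<^sub>R A) *v (inverse s *\<^sub>R v)" for v
    using assms by (simp add: eq)
  show ?thesis
    unfolding range_space_def
    by (intro equalityI image_subsetI) (metis eq rangeI, metis eq' rangeI)
qed

lemma outer_scale: "outer (c *s z) = (cmod c)\<^sup>2 *\<^sub>R outer z"
proof -
  have "c * cnj c = of_real ((cmod c)\<^sup>2)" by (simp add: complex_mult_cnj cmod_power2)
  then have "c * x * (cnj c * y) = (cmod c)\<^sup>2 *\<^sub>R (x * y)" for x y
    unfolding scaleR_conv_of_real by (metis mult.assoc mult.left_commute)
  then show ?thesis by (simp add: outer_def vec_eq_iff)
qed

text \<open>The range of \<open>outer z\<close> is the complex line through \<open>z\<close>, and a
  range is closed under complex multiples. The vector \<open>z\<close> is recovered from its own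
  image, which is \<open>z\<close> times its squared norm.\<close>

lemma range_space_outer_subset_iff: "range_space (outer z) \<subseteq> range_space A \<longleftrightarrow> z \<in> range_space A"
proof
  assume sub: "range_space (outer z) \<subseteq> range_space A"
  define c where "c = (\<Sum>q\<in>UNIV. cnj (z $ q) * z $ q)"
  have z: "outer z *v z = c *s z" by (simp add: outer_mult_vec c_def)
  have "z \<in> range_space (outer z)"
  proof (cases "z = 0")
    case True
    then show ?thesis by (auto simp: range_space_def intro!: image_eqI[of _ _ 0])
  next
    case False
    then have "Re c \<noteq> 0" unfolding c_def inner_complex_vec[symmetric] by simp
    then have "c \<noteq> 0" by auto
    then have "z = outer z *v (inverse c *s z)"
      by (simp add: z vector_scalar_commute)
    then show ?thesis unfolding range_space_def by blast
  qed
  then show "z \<in> range_space A" using sub by blast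
next
  assume "z \<in> range_space A"
  then obtain w where "z = A *v w" by (auto simp: range_space_def)
  then have "outer z *v v = A *v ((\<Sum>q\<in>UNIV. cnj (z $ q) * v $ q) *s w)" for v
    by (simp only: outer_mult_vec vector_scalar_commute)
  then show "range_space (outer z) \<subseteq> range_space A" by (auto simp: range_space_def)
qed

subsection \<open>Separable states\<close>

lemma partial_transpose_0: "partial_transpose 0 = 0"
  and partial_transpose_add: "partial_transpose (A + B) = partial_transpose A + partial_transpose B"
  and partial_transpose_scaleR: "partial_transpose (s *\<^sub>R A) = s *\<^sub>R partial_transpose A"
  by (simp_all add: partial_transpose_def vec_eq_iff)

text \<open>Transposing the rank one matrix of \<open>x\<close> in the first tensor factor
  conjugates \<open>x\<close>; hence the \<open>cnj_vec\<close> in \<open>QQ\<close>.\<close>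

lemma partial_transpose_outer_prod_vec:
  "partial_transpose (outer (x \<otimes>\<^sub>v y)) = outer (cnj_vec x \<otimes>\<^sub>v y)"
  by (simp add: partial_transpose_def outer_def prod_vec_def cnj_vec_def vec_eq_iff mult_ac)

lemma prod_vec_scale: "c *s (x \<otimes>\<^sub>v y) = (c *s x) \<otimes>\<^sub>v y"
  by (simp add: prod_vec_def vec_eq_iff)

text \<open>Sums in \<open>VV1\<close> carry no coefficients, so a nonnegative factor is absorbed
  into the vectors through its square root.\<close>

lemma outer_sqrt_scale: "0 \<le> s \<Longrightarrow> outer (complex_of_real (sqrt s) *s z) = s *\<^sub>R outer z"
  by (simp add: outer_scale)

lemma convex_cone_VV1: "convex_cone VV1"
  unfolding convex_cone_iff
proof (intro conjI ballI allI impI)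
  show "0 \<in> VV1" by (auto simp: VV1_def intro!: exI[of _ "[]"])
next
  fix A B :: "('m::finite, 'n::finite) bimat" assume "A \<in> VV1" "B \<in> VV1"
  then obtain zs ws where
    "\<forall>z\<in>set zs. \<exists>x y. z = x \<otimes>\<^sub>v y" "A = (\<Sum>z\<leftarrow>zs. outer z)"
    "\<forall>z\<in>set ws. \<exists>x y. z = x \<otimes>\<^sub>v y" "B = (\<Sum>z\<leftarrow>ws. outer z)"
    unfolding VV1_def by blast
  then have "(\<forall>z\<in>set (zs @ ws). \<exists>x y. z = x \<otimes>\<^sub>v y) \<and> A + B = (\<Sum>z\<leftarrow>zs @ ws. outer z)"
    by auto
  then show "A + B \<in> VV1" unfolding VV1_def by blast
next
  fix A :: "('m::finite, 'n::finite) bimat" and s :: real assume "A \<in> VV1" and s: "0 \<le> s"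
  then obtain zs where
    zs: "\<forall>z\<in>set zs. \<exists>x y. z = x \<otimes>\<^sub>v y" "A = (\<Sum>z\<leftarrow>zs. outer z)"
    unfolding VV1_def by blast
  let ?ws = "map ((*s) (complex_of_real (sqrt s))) zs"
  have "s *\<^sub>R (\<Sum>z\<leftarrow>zs. outer z) = (\<Sum>w\<leftarrow>?ws. outer w)"
    by (induction zs) (simp_all add: scaleR_right_distrib outer_sqrt_scale s)
  moreover have "\<forall>w\<in>set ?ws. \<exists>x y. w = x \<otimes>\<^sub>v y"
    using zs(1) prod_vec_scale by fastforce
  ultimately show "s *\<^sub>R A \<in> VV1" unfolding VV1_def zs(2) by blast
qed

lemma outer_prod_vec_in_VV1: "outer (x \<otimes>\<^sub>v y) \<in> VV1"
  unfolding VV1_def by (rule CollectI, rule exI[of _ "[x \<otimes>\<^sub>v y]"]) auto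

lemma VV1_subset_TT: "VV1 \<subseteq> TT"
proof
  fix A :: "('m::finite, 'n::finite) bimat" assume "A \<in> VV1"
  then obtain zs where
    zs: "\<forall>z\<in>set zs. \<exists>x y. z = x \<otimes>\<^sub>v y" "A = (\<Sum>z\<leftarrow>zs. outer z)"
    unfolding VV1_def by blast
  have "(\<Sum>z\<leftarrow>zs. outer z) \<in> TT" using zs(1)
    by (induction zs)
      (auto simp: TT_def psd_0 psd_add psd_outer partial_transpose_0 partial_transpose_add
        partial_transpose_outer_prod_vec)
  then show "A \<in> TT" using zs by simp
qed

section \<open>Comparison of the faces of \<open>VV1\<close> and \<open>TT\<close>\<close>

lemma add_in_TT_face:
  assumes "B \<in> TT" "D \<in> TT"
  shows "B \<in> TT_face (B + D)"
  using assms unfolding TT_face_def TT_def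
  by (simp add: range_space_subset_add partial_transpose_add)

lemma TT_face_trans: "B \<in> TT_face D \<Longrightarrow> D \<in> TT_face A \<Longrightarrow> B \<in> TT_face A"
  unfolding TT_face_def by blast

lemma TT_face_scaleR_D:
  assumes "B \<in> TT" "s \<noteq> 0" "s *\<^sub>R B \<in> TT_face A"
  shows "B \<in> TT_face A"
  using assms unfolding TT_face_def by (simp add: partial_transpose_scaleR range_space_scaleR)

lemma VV1_face_eq:
  "A \<in> VV1 \<Longrightarrow> VV1_face A = {B \<in> VV1. \<exists>s>0. A - s *\<^sub>R B \<in> VV1}"
  unfolding VV1_face_def by (rule smallest_face_convex_cone[OF convex_cone_VV1])

text \<open>If \<open>A - s *\<^sub>R B\<close> is separable, then \<open>s *\<^sub>R B\<close> is a
  summand of \<open>A\<close> within \<open>TT\<close>, and scaling by \<open>s\<close> changes no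
  range. Only the reverse inclusion is thus at stake in the theorem.\<close>

lemma VV1_face_subset_TT_face:
  assumes A: "A \<in> VV1"
  shows "VV1_face A \<subseteq> VV1 \<inter> TT_face A"
proof
  fix B assume "B \<in> VV1_face A"
  then obtain s where B: "B \<in> VV1" and s: "s > 0" and D: "A - s *\<^sub>R B \<in> VV1"
    using VV1_face_eq[OF A] by blast
  have "s *\<^sub>R B \<in> VV1" using B s by (simp add: convex_cone_scaleR[OF convex_cone_VV1])
  then have "s *\<^sub>R B \<in> TT_face A"
    using add_in_TT_face[of "s *\<^sub>R B" "A - s *\<^sub>R B"] D VV1_subset_TT by auto
  then show "B \<in> VV1 \<inter> TT_face A"
    using TT_face_scaleR_D[of B s A] B s VV1_subset_TT by auto
qed

lemma outer_in_TT_face_iff: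
  "outer (x \<otimes>\<^sub>v y) \<in> TT_face A \<longleftrightarrow>
     x \<otimes>\<^sub>v y \<in> range_space A \<and> cnj_vec x \<otimes>\<^sub>v y \<in> range_space (partial_transpose A)"
proof -
  have "outer (x \<otimes>\<^sub>v y) \<in> TT" using outer_prod_vec_in_VV1 VV1_subset_TT by (rule subsetD[rotated])
  then show ?thesis
    by (simp add: TT_face_def partial_transpose_outer_prod_vec range_space_outer_subset_iff)
qed

text \<open>This brings \<open>QQ\<close> into the shape of \<open>PP\<close>, with
  \<open>VV1_face A\<close> replaced by \<open>VV1 \<inter> TT_face A\<close>.\<close>

lemma QQ_eq: "QQ A = {z. \<exists>x y. z = x \<otimes>\<^sub>v y \<and> outer z \<in> VV1 \<inter> TT_face A}"
  unfolding QQ_def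
  by (intro Collect_cong ex_cong1 conj_cong refl)
    (simp add: outer_in_TT_face_iff outer_prod_vec_in_VV1)

lemma PP_subset_QQ:
  assumes "A \<in> VV1"
  shows "PP A \<subseteq> QQ A"
  unfolding PP_def QQ_eq using VV1_face_subset_TT_face[OF assms] by blast

lemma outer_summand_in_VV1_face:
  assumes A: "A \<in> VV1" and zs: "A = (\<Sum>z\<leftarrow>zs. outer z)" "\<forall>z\<in>set zs. \<exists>x y. z = x \<otimes>\<^sub>v y"
    and z: "z \<in> set zs"
  shows "outer z \<in> VV1_face A"
proof -
  \<comment> \<open>Only one occurrence is removed, since a vector may be repeated in the
    list.\<close>
  have "A - 1 *\<^sub>R outer z = (\<Sum>w\<leftarrow>remove1 z zs. outer w)"
    using sum_list_map_remove1[OF z, of outer] zs by simp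
  moreover have "\<forall>w\<in>set (remove1 z zs). \<exists>x y. w = x \<otimes>\<^sub>v y"
    using zs(2) by (meson notin_set_remove1)
  then have "(\<Sum>w\<leftarrow>remove1 z zs. outer w) \<in> VV1"
    unfolding VV1_def by blast
  ultimately have "A - 1 *\<^sub>R outer z \<in> VV1" by simp
  moreover obtain x y where "z = x \<otimes>\<^sub>v y" using zs(2) z by blast
  then have "outer z \<in> VV1" by (simp add: outer_prod_vec_in_VV1)
  ultimately show ?thesis unfolding VV1_face_eq[OF A] using zero_less_one by blast
qed

section \<open>The equivalences\<close>

text \<open>Extending the segment from \<open>B\<close> beyond \<open>A\<close> and subtracting a
  multiple of \<open>B\<close> from \<open>A\<close> differ only by a positive factor: parameter
  \<open>t\<close> corresponds to the multiple \<open>s = (t - 1) / t\<close>, that is,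
  \<open>t = 1 / (1 - s)\<close>.\<close>

lemma interior_point_iff_VV1_face_eq:
  assumes A: "A \<in> VV1"
  shows "interior_point A (VV1 \<inter> TT_face A) \<longleftrightarrow> VV1_face A = VV1 \<inter> TT_face A"
proof
  assume int: "interior_point A (VV1 \<inter> TT_face A)"
  have "B \<in> VV1_face A" if "B \<in> VV1 \<inter> TT_face A" for B
  proof -
    from int that obtain t where t: "t > 1" "(1 - t) *\<^sub>R B + t *\<^sub>R A \<in> VV1"
      unfolding interior_point_def by blast
    have "A - ((t - 1) / t) *\<^sub>R B = (1 / t) *\<^sub>R ((1 - t) *\<^sub>R B + t *\<^sub>R A)"
      using t(1) by (simp add: algebra_simps diff_divide_distrib)
    also have "\<dots> \<in> VV1" using t by (simp add: convex_cone_scaleR[OF convex_cone_VV1])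
    finally have "A - ((t - 1) / t) *\<^sub>R B \<in> VV1" .
    moreover have "(t - 1) / t > 0" using t by simp
    ultimately show ?thesis using that VV1_face_eq[OF A] by blast
  qed
  then show "VV1_face A = VV1 \<inter> TT_face A" using VV1_face_subset_TT_face[OF A] by blast
next
  assume eq: "VV1_face A = VV1 \<inter> TT_face A"
  have "A \<in> VV1_face A"
    using A VV1_face_eq[OF A]
    by (auto intro!: exI[of _ 1] simp: convex_cone_contains_0[OF convex_cone_VV1])
  moreover have "\<exists>t>1. (1 - t) *\<^sub>R B + t *\<^sub>R A \<in> VV1_face A" if "B \<in> VV1_face A" for B
  proof -
    obtain r where r: "B \<in> VV1" "r > 0" "A - r *\<^sub>R B \<in> VV1"
      using \<open>B \<in> VV1_face A\<close> VV1_face_eq[OF A] by blast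
    define s where "s = min r (1/2)"
    have s: "0 < s" "s < 1" and AsB: "A - s *\<^sub>R B \<in> VV1"
      using convex_cone_diff_scaleR_mono[OF convex_cone_VV1 A r(3)] r by (auto simp: s_def)
    \<comment> \<open>The remainder is itself in the face, because subtracting it from
      \<open>A\<close> leaves the separable \<open>s *\<^sub>R B\<close>.\<close>
    have "A - 1 *\<^sub>R (A - s *\<^sub>R B) \<in> VV1"
      using r s by (simp add: convex_cone_scaleR[OF convex_cone_VV1])
    then have "A - s *\<^sub>R B \<in> VV1_face A" using AsB VV1_face_eq[OF A] zero_less_one by blast
    moreover have "convex_cone (VV1_face A)"
      unfolding VV1_face_def using convex_cone_VV1 A by (rule convex_cone_smallest_face)
    ultimately have "(1 / (1 - s)) *\<^sub>R (A - s *\<^sub>R B) \<in> VV1_face A"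
      using s by (simp add: convex_cone_scaleR)
    also have "(1 / (1 - s)) *\<^sub>R (A - s *\<^sub>R B) = (1 - 1 / (1 - s)) *\<^sub>R B + (1 / (1 - s)) *\<^sub>R A"
    proof -
      have "1 - 1 / (1 - s) = - (s / (1 - s))" using s by (simp add: field_simps)
      then show ?thesis by (simp add: scaleR_diff_right)
    qed
    finally have "(1 - 1 / (1 - s)) *\<^sub>R B + (1 / (1 - s)) *\<^sub>R A \<in> VV1_face A" .
    moreover have "1 / (1 - s) > 1" using s by simp
    ultimately show ?thesis by blast
  qed
  ultimately show "interior_point A (VV1 \<inter> TT_face A)"
    unfolding interior_point_def eq[symmetric] by blast
qed

text \<open>For the converse, split \<open>B\<close> into product vectors. Each of them lies in
  \<open>QQ A\<close> because its rank one matrix is in \<open>TT_face B\<close>, hence in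
  \<open>TT_face A\<close>; the face of \<open>VV1\<close> is a cone and so contains their
  sum.\<close>

lemma VV1_face_eq_iff_PP_eq_QQ:
  assumes A: "A \<in> VV1"
  shows "VV1_face A = VV1 \<inter> TT_face A \<longleftrightarrow> PP A = QQ A"
proof
  assume "VV1_face A = VV1 \<inter> TT_face A"
  then show "PP A = QQ A" unfolding PP_def QQ_eq by simp
next
  assume eq: "PP A = QQ A"
  have "B \<in> VV1_face A" if B: "B \<in> VV1" "B \<in> TT_face A" for B
  proof -
    from B(1) obtain zs where
      zs: "B = (\<Sum>z\<leftarrow>zs. outer z)" "\<forall>z\<in>set zs. \<exists>x y. z = x \<otimes>\<^sub>v y"
      unfolding VV1_def by blast
    have "outer z \<in> VV1_face A" if "z \<in> set zs" for z
    proof -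
      have "outer z \<in> VV1 \<inter> TT_face B"
        using outer_summand_in_VV1_face[OF B(1) zs that] VV1_face_subset_TT_face[OF B(1)] by blast
      then have "z \<in> QQ A" using zs(2) that TT_face_trans B(2) unfolding QQ_eq by blast
      then show ?thesis unfolding eq[symmetric] PP_def by blast
    qed
    moreover have "convex_cone (VV1_face A)"
      unfolding VV1_face_def using convex_cone_VV1 A by (rule convex_cone_smallest_face)
    ultimately show ?thesis unfolding zs(1) by (simp add: convex_cone_sum_list)
  qed
  then show "VV1_face A = VV1 \<inter> TT_face A" using VV1_face_subset_TT_face[OF A] by blast
qed

text \<open>Subtracting \<open>s\<close> times \<open>outer z\<close> from \<open>A\<close> is the
  same as splitting off \<open>outer (c *s z)\<close> with \<open>s\<close> the squared modulus of
  \<open>c\<close>, so a decomposition starting with a multiple of \<open>z\<close> expresses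
  membership of \<open>outer z\<close> in the face.\<close>

lemma PP_eq_QQ_iff_decomposition:
  assumes A: "A \<in> VV1"
  shows "PP A = QQ A \<longleftrightarrow>
    (\<forall>z\<in>QQ A. \<exists>(c::complex) zs. c \<noteq> 0 \<and> set zs \<subseteq> QQ A \<and>
      A = outer (c *s z) + (\<Sum>w\<leftarrow>zs. outer w))" (is "_ \<longleftrightarrow> ?R")
proof
  assume eq: "PP A = QQ A"
  show ?R
  proof
    fix z assume "z \<in> QQ A"
    then have "z \<in> PP A" by (simp only: eq)
    then obtain x y where z: "z = x \<otimes>\<^sub>v y" "outer z \<in> VV1_face A"
      unfolding PP_def by (elim CollectE exE conjE)
    from z(2) obtain s where s: "s > 0" "A - s *\<^sub>R outer z \<in> VV1"
      unfolding VV1_face_eq[OF A] by (elim CollectE exE conjE)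
    from s(2) obtain zs where zs: "A - s *\<^sub>R outer z = (\<Sum>w\<leftarrow>zs. outer w)"
      "\<forall>w\<in>set zs. \<exists>x y. w = x \<otimes>\<^sub>v y"
      unfolding VV1_def by blast
    define c where "c = complex_of_real (sqrt s)"
    have c: "c \<noteq> 0" "outer (c *s z) = s *\<^sub>R outer z"
      using s by (simp_all add: c_def outer_sqrt_scale)
    have A_eq: "A = outer (c *s z) + (\<Sum>w\<leftarrow>zs. outer w)"
      by (simp add: c flip: zs(1))
    have "w \<in> PP A" if "w \<in> set zs" for w
    proof -
      \<comment> \<open>With \<open>c *s z\<close> prepended, the list decomposes \<open>A\<close>
        itself, so each of its vectors gives a summand of \<open>A\<close> in the face.\<close>
      have "\<forall>w\<in>set ((c *s z) # zs). \<exists>x y. w = x \<otimes>\<^sub>v y"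
        using zs(2) prod_vec_scale unfolding z(1) by (metis set_ConsD)
      moreover have "A = (\<Sum>w\<leftarrow>(c *s z) # zs. outer w)" using A_eq by simp
      ultimately have "outer w \<in> VV1_face A"
        using outer_summand_in_VV1_face[OF A, of "(c *s z) # zs"] that by simp
      then show ?thesis using zs(2) that unfolding PP_def by blast
    qed
    then show "\<exists>c zs. c \<noteq> 0 \<and> set zs \<subseteq> QQ A \<and> A = outer (c *s z) + (\<Sum>w\<leftarrow>zs. outer w)"
      using c A_eq eq by blast
  qed
next
  assume R: ?R
  have "z \<in> PP A" if zQ: "z \<in> QQ A" for z
  proof -
    from R zQ obtain c zs where c: "c \<noteq> 0" and zs: "set zs \<subseteq> QQ A"
      and A_eq: "A = outer (c *s z) + (\<Sum>w\<leftarrow>zs. outer w)" by blast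
    have "(\<Sum>w\<leftarrow>zs. outer w) \<in> VV1"
      using zs unfolding QQ_eq by (intro convex_cone_sum_list[OF convex_cone_VV1]) blast
    moreover have "A - (cmod c)\<^sup>2 *\<^sub>R outer z = (\<Sum>w\<leftarrow>zs. outer w)"
      using A_eq by (simp add: outer_scale)
    ultimately have "A - (cmod c)\<^sup>2 *\<^sub>R outer z \<in> VV1" by simp
    moreover have "(cmod c)\<^sup>2 > 0" using c by simp
    ultimately show ?thesis using zQ unfolding QQ_eq PP_def VV1_face_eq[OF A] by blast
  qed
  then show "PP A = QQ A" using PP_subset_QQ[OF A] by blast
qed

theorem theorem2p2:
  fixes A :: "complex ^ ('m::finite \<times> 'n::finite) ^ ('m \<times> 'n)"
  assumes "A \<in> VV1"
  shows "(VV1_face A = VV1 \<inter> TT_face A \<longleftrightarrow> interior_point A (VV1 \<inter> TT_face A)) \<and>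
         (interior_point A (VV1 \<inter> TT_face A) \<longleftrightarrow> PP A = QQ A) \<and>
         (PP A = QQ A \<longleftrightarrow>
           (\<forall>z\<in>QQ A. \<exists>(c::complex) zs. c \<noteq> 0 \<and> set zs \<subseteq> QQ A \<and>
              A = outer (c *s z) + (\<Sum>w\<leftarrow>zs. outer w)))"
  using interior_point_iff_VV1_face_eq[OF assms] VV1_face_eq_iff_PP_eq_QQ[OF assms]
    PP_eq_QQ_iff_decomposition[OF assms]
  by blast

end
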